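(* For every $m,n\in\mathbb{N}$, the total number $s(m,n)$ of subgroups of the group $\mathbb{Z}_m\times\mathbb{Z}_n$ is given by $$s(m,n)=\sum_{i\mid m,\ j\mid n}\gcd(i,j)=\sum_{t\mid \gcd(m,n)}\phi(t)\,\tau\left(\frac{m}{t}\right)\tau\left(\frac{n}{t}\right).$$
   Context: $\mathbb{N}=\{1,2,\ldots\}$. $\mathbb{Z}_m$ denotes the additive group of residue classes modulo $m$. $\phi$ is Euler's totient function and $\tau(k)$ is the number of positive divisors of $k$. Sums over divisors run over positive divisors. *)

theory Defs
  imports "HOL-Algebra.Elementary_Groups" "HOL-Number_Theory.Totient"
begin

definition subgroup_count :: "nat \<Rightarrow> nat \<Rightarrow> nat" where
  "subgroup_count m n =
     card {H. subgroup H (integer_mod_group m \<times>\<times> integer_mod_group n)}"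

definition divisor_count :: "nat \<Rightarrow> nat" where
  "divisor_count k = card {d. d dvd k}"

end

theory Submission
  imports Defs "HOL-Library.Product_Plus"
begin

text \<open>
  Subgroups of \<open>Z_m \<times> Z_n\<close> correspond to subgroups of \<open>Z \<times> Z\<close> containing \<open>(m, 0)\<close> and \<open>(0, n)\<close>.
  Each of these has a unique Hermite basis \<open>(a, t)\<close>, \<open>(0, b)\<close> with \<open>0 \<le> t < b\<close>. Such a basis yields
  \<open>(m, 0)\<close> and \<open>(0, n)\<close> iff \<open>a\<close> divides \<open>m\<close>, \<open>b\<close> divides \<open>n\<close> and \<open>b\<close> divides \<open>(m / a) t\<close>, and the last
  condition has \<open>gcd (m / a) b\<close> solutions \<open>t\<close>. The second formula follows by expanding
  \<open>gcd i j\<close> as the sum of \<open>\<phi> t\<close> over the common divisors \<open>t\<close> and exchanging the sums.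
\<close>

section \<open>Subgroups of the integers\<close>

text \<open>Division with remainder by the least positive element \<open>d\<close> leaves a smaller
  nonnegative element of \<open>A\<close>, which must be 0. The member \<open>m\<close> ensures that
  such a \<open>d\<close> exists and makes it a divisor of \<open>m\<close>.\<close>

lemma int_subgroup_eq_multiples:
  fixes A :: "int set" and m :: nat
  assumes "m \<ge> 1" and m: "int m \<in> A" and diff: "\<And>x y. x \<in> A \<Longrightarrow> y \<in> A \<Longrightarrow> x - y \<in> A"
  obtains d :: nat where "d dvd m" and "A = {x. int d dvd x}"
proof -
  have zero: "0 \<in> A" using diff[OF m m] by simp
  have neg: "- x \<in> A" if "x \<in> A" for x using diff[OF zero that] by simp
  have add: "x + y \<in> A" if "x \<in> A" "y \<in> A" for x y using diff[OF that(1) neg[OF that(2)]] by simp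
  have nmul: "int k * x \<in> A" if "x \<in> A" for k x
    by (induction k) (auto simp: zero algebra_simps intro: add that)
  have mul: "k * x \<in> A" if "x \<in> A" for k x
    using nmul[OF that, of "nat \<bar>k\<bar>"] neg[OF nmul[OF that, of "nat \<bar>k\<bar>"]]
    by (cases "k \<ge> 0") auto
  define d where "d = (LEAST d. d \<ge> 1 \<and> int d \<in> A)"
  have d: "d \<ge> 1 \<and> int d \<in> A"
    unfolding d_def by (rule LeastI[of _ m]) (use assms in auto)
  have "int d dvd x" if "x \<in> A" for x
  proof (rule ccontr)
    assume "\<not> int d dvd x"
    then have pos: "x mod int d > 0" using d by (simp add: dvd_eq_mod_eq_0 order_less_le)
    have "x mod int d = x - (x div int d) * int d" by (simp add: minus_div_mult_eq_mod)
    then have "x mod int d \<in> A" using diff[OF that mul[of "int d" "x div int d"]] d by simp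
    then have "d \<le> nat (x mod int d)"
      unfolding d_def by (intro Least_le) (use pos d_def in auto)
    moreover have "x mod int d < int d" using d by simp
    ultimately show False using pos by linarith
  qed
  moreover have "x \<in> A" if "int d dvd x" for x
    using that d mul[of "int d"] by (auto simp: dvd_def mult.commute)
  ultimately have A: "A = {x. int d dvd x}" by blast
  moreover have "d dvd m" using A m by auto
  ultimately show thesis using that by blast
qed

section \<open>Correspondence with subgroups of Z x Z\<close>

text \<open>Nonempty sets closed under differences are subgroups, so these are the subgroups of Z x
  Z that contain mZ x nZ.\<close>

definition period_lattices :: "nat \<Rightarrow> nat \<Rightarrow> (int \<times> int) set set" where
  "period_lattices m n =
     {K. (int m, 0) \<in> K \<and> (0, int n) \<in> K \<and> (\<forall>p\<in>K. \<forall>q\<in>K. p - q \<in> K)}"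

context
  fixes m n :: nat and K :: "(int \<times> int) set"
  assumes K: "K \<in> period_lattices m n"
begin

lemma lattice_diff: "p \<in> K \<Longrightarrow> q \<in> K \<Longrightarrow> p - q \<in> K"
  using K by (simp add: period_lattices_def)

lemma lattice_zero: "(0, 0) \<in> K"
  using lattice_diff[of "(int m, 0)" "(int m, 0)"] K by (simp add: period_lattices_def zero_prod_def)

lemma lattice_add:
  assumes "(x, y) \<in> K" "(x', y') \<in> K"
  shows "(x + x', y + y') \<in> K"
  using lattice_diff[OF assms(1) lattice_diff[OF lattice_zero assms(2)]] by simp

lemma lattice_scale:
  assumes "(x, y) \<in> K"
  shows "(k * x, k * y) \<in> K"
proof -
  have *: "(int j * x, int j * y) \<in> K" for j
    by (induction j) (auto simp: lattice_zero algebra_simps intro: lattice_add assms)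
  show ?thesis
    using *[of "nat \<bar>k\<bar>"] lattice_diff[OF lattice_zero *[of "nat \<bar>k\<bar>"]]
    by (cases "k \<ge> 0") auto
qed

lemma lattice_mod_iff: "(x mod int m, y mod int n) \<in> K \<longleftrightarrow> (x, y) \<in> K"
proof -
  \<comment> \<open>The zero coordinate stays a product so that \<open>lattice_scale\<close>
    matches; hence \<open>mult_zero_right\<close> is removed.\<close>
  have "(x div int m * int m, x div int m * 0) \<in> K" "(y div int n * 0, y div int n * int n) \<in> K"
    using K by (auto simp: period_lattices_def simp del: mult_zero_right intro!: lattice_scale)
  then have q: "(x div int m * int m, y div int n * int n) \<in> K"
    using lattice_add[of "x div int m * int m" 0 0 "y div int n * int n"] by simp
  show ?thesis
    using lattice_add[OF _ q, of "x mod int m" "y mod int n"] lattice_diff[OF _ q, of "(x, y)"]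
    by (auto simp: minus_div_mult_eq_mod)
qed

end

text \<open>This is the correspondence theorem for the reduction map \<open>?red\<close> from Z x Z
  onto the group: subgroups are matched with their preimages. As the carrier consists of the
  standard representatives, intersecting with it undoes taking the preimage.\<close>

lemma card_subgroups_eq_card_period_lattices:
  assumes "m \<ge> 1" "n \<ge> 1"
  shows "subgroup_count m n = card (period_lattices m n)"
proof -
  let ?G = "integer_mod_group m \<times>\<times> integer_mod_group n"
  let ?red = "\<lambda>(x, y). (x mod int m, y mod int n)"
  interpret G: group ?G by (simp add: DirProd_group)
  have carrier: "carrier (integer_mod_group m) = {0..<int m}" "carrier (integer_mod_group n) = {0..<int n}"
    using assms by (auto simp: carrier_integer_mod_group)
  have inv: "inv\<^bsub>?G\<^esub> (x, y) = ((- x) mod int m, (- y) mod int n)"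
    if "(x, y) \<in> carrier ?G" for x y
    using that by (simp add: inv_DirProd)
  have "bij_betw (\<lambda>H. {p. ?red p \<in> H}) {H. subgroup H ?G} (period_lattices m n)"
  proof (rule bij_betw_byWitness[where f' = "\<lambda>K. K \<inter> carrier ?G"])
    show "\<forall>H\<in>{H. subgroup H ?G}. {p. ?red p \<in> H} \<inter> carrier ?G = H"
    proof
      fix H assume "H \<in> {H. subgroup H ?G}"
      then have "H \<subseteq> {0..<int m} \<times> {0..<int n}"
        using subgroup.subset[of H ?G] by (simp only: carrier carrier_DirProd mem_Collect_eq)
      then show "{p. ?red p \<in> H} \<inter> carrier ?G = H"
        unfolding carrier_DirProd carrier by auto
    qed
    show "\<forall>K\<in>period_lattices m n. {p. ?red p \<in> K \<inter> carrier ?G} = K"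
    proof
      fix K assume "K \<in> period_lattices m n"
      from lattice_mod_iff[OF this] show "{p. ?red p \<in> K \<inter> carrier ?G} = K"
        using assms by (simp add: carrier set_eq_iff)
    qed
    show "(\<lambda>H. {p. ?red p \<in> H}) ` {H. subgroup H ?G} \<subseteq> period_lattices m n"
    proof clarify
      fix H assume H: "subgroup H ?G"
      have "?red (x - x', y - y') \<in> H" if "?red (x, y) \<in> H" "?red (x', y') \<in> H" for x y x' y'
      proof -
        have "?red (x, y) \<otimes>\<^bsub>?G\<^esub> inv\<^bsub>?G\<^esub> (?red (x', y')) \<in> H"
          using H that by (simp add: subgroup.m_closed subgroup.m_inv_closed)
        moreover have "(x' mod int m, y' mod int n) \<in> carrier ?G"
          using assms by (simp add: carrier)
        ultimately show ?thesis
          by (simp add: inv mod_simps)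
      qed
      moreover have "(0, 0) \<in> H" using subgroup.one_closed[OF H] by simp
      ultimately show "{p. ?red p \<in> H} \<in> period_lattices m n"
        by (auto simp: period_lattices_def)
    qed
    show "(\<lambda>K. K \<inter> carrier ?G) ` period_lattices m n \<subseteq> {H. subgroup H ?G}"
    proof clarify
      fix K assume K: "K \<in> period_lattices m n"
      show "subgroup (K \<inter> carrier ?G) ?G"
      proof (rule G.subgroupI)
        show "K \<inter> carrier ?G \<noteq> {}"
          using lattice_zero[OF K] assms by (auto simp: carrier)
        fix p assume p: "p \<in> K \<inter> carrier ?G"
        obtain x y where xy: "p = (x, y)" by fastforce
        have "(- x, - y) \<in> K" using lattice_scale[OF K, of x y "-1"] p xy by simp
        then show "inv\<^bsub>?G\<^esub> p \<in> K \<inter> carrier ?G"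
          using p xy assms by (simp add: inv lattice_mod_iff[OF K] carrier)
        fix q assume q: "q \<in> K \<inter> carrier ?G"
        obtain x' y' where xy': "q = (x', y')" by fastforce
        have "(x + x', y + y') \<in> K" using lattice_add[OF K] p q xy xy' by simp
        then show "p \<otimes>\<^bsub>?G\<^esub> q \<in> K \<inter> carrier ?G"
          using p xy xy' assms by (simp add: lattice_mod_iff[OF K] carrier)
      qed auto
    qed
  qed
  then show ?thesis
    by (simp add: subgroup_count_def bij_betw_same_card)
qed

section \<open>Hermite bases\<close>

text \<open>The lattice spanned by \<open>(a, t)\<close> and \<open>(0, b)\<close>.\<close>

definition hermite_lattice :: "nat \<times> nat \<times> nat \<Rightarrow> (int \<times> int) set" where
  "hermite_lattice = (\<lambda>(a, b, t). {(x, y). int a dvd x \<and> int b dvd y - x div int a * int t})"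

text \<open>The last condition places (m, 0) in the lattice: \<open>m div a\<close> copies of (a, t)
  give (m, (m/a) t), whose second entry must be cleared by multiples of (0, b).\<close>

definition hermite_params :: "nat \<Rightarrow> nat \<Rightarrow> (nat \<times> nat \<times> nat) set" where
  "hermite_params m n =
     (SIGMA a:{d. d dvd m}. SIGMA b:{d. d dvd n}. {t. t < b \<and> b dvd (m div a) * t})"

lemma hermite_lattice_in_period_lattices:
  assumes p: "p \<in> hermite_params m n"
  shows "hermite_lattice p \<in> period_lattices m n"
proof -
  obtain a b t where abt: "p = (a, b, t)" "a dvd m" "b dvd n" "b dvd (m div a) * t"
    using p by (auto simp: hermite_params_def)
  have "int b dvd int (m div a) * int t"
    using abt(4) by (metis of_nat_dvd_iff of_nat_mult)
  then have "int b dvd int m div int a * int t" by (simp add: zdiv_int)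
  moreover have "int b dvd (y - y') - (x - x') div int a * int t"
    if "int a dvd x" "int a dvd x'" "int b dvd y - x div int a * int t"
      "int b dvd y' - x' div int a * int t" for x y x' y'
  proof -
    \<comment> \<open>Division by \<open>a\<close> is additive on multiples of \<open>a\<close>, so
      the defining congruence is linear there.\<close>
    have "(y - y') - (x - x') div int a * int t
        = (y - x div int a * int t) - (y' - x' div int a * int t)"
      unfolding div_diff[OF that(1,2)] left_diff_distrib by simp
    then show ?thesis using dvd_diff[OF that(3,4)] by metis
  qed
  ultimately show ?thesis
    using abt by (auto simp: period_lattices_def hermite_lattice_def)
qed

text \<open>The parameters can be read off the lattice: \<open>a\<close> generates its first
  projection, \<open>b\<close> generates its fibre over 0, and \<open>t\<close> is the residue mod
  \<open>b\<close> of the fibre over \<open>a\<close>. The proof compares both lattices at points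
  testing these three features.\<close>

lemma inj_on_hermite_lattice:
  assumes "m \<ge> 1"
  shows "inj_on hermite_lattice (hermite_params m n)"
proof (rule inj_onI)
  fix p p' assume p: "p \<in> hermite_params m n" and p': "p' \<in> hermite_params m n"
    and eq: "hermite_lattice p = hermite_lattice p'"
  obtain a b t where abt: "p = (a, b, t)" "a dvd m" "t < b"
    using p by (auto simp: hermite_params_def)
  obtain a' b' t' where abt': "p' = (a', b', t')" "a' dvd m" "t' < b'"
    using p' by (auto simp: hermite_params_def)
  have pos: "a > 0" "a' > 0" using abt abt' assms by (auto intro: Nat.gr0I)
  have iff: "int a dvd x \<and> int b dvd y - x div int a * int t \<longleftrightarrow>
      int a' dvd x \<and> int b' dvd y - x div int a' * int t'" for x y
    using eq by (auto simp: abt(1) abt'(1) hermite_lattice_def set_eq_iff)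
  have "a = a'"
    using iff[of "int a" "int t"] iff[of "int a'" "int t'"] pos
    by (auto intro: dvd_antisym)
  moreover have "b = b'"
    using iff[of 0 "int b"] iff[of 0 "int b'"] by (auto intro: dvd_antisym)
  moreover have "t = t'"
  proof -
    have "int b dvd int t' - int t"
      using iff[of "int a" "int t'"] pos \<open>a = a'\<close> by auto
    then have "int t' mod int b = int t mod int b" by (simp add: mod_eq_dvd_iff)
    then show ?thesis using abt(3) abt'(3) \<open>b = b'\<close> by simp
  qed
  ultimately show "p = p'" by (simp add: abt(1) abt'(1))
qed

text \<open>Both the first projection of \<open>K\<close> and its fibre over 0 are subgroups of Z;
  their generators serve as \<open>a\<close> and \<open>b\<close>.\<close>

lemma period_lattice_is_hermite:
  assumes "m \<ge> 1" "n \<ge> 1" and K: "K \<in> period_lattices m n"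
  shows "K \<in> hermite_lattice ` hermite_params m n"
proof -
  have mK: "(int m, 0) \<in> K" and nK: "(0, int n) \<in> K"
    using K by (auto simp: period_lattices_def)
  obtain a where a: "a dvd m" "fst ` K = {x. int a dvd x}"
  proof (rule int_subgroup_eq_multiples[OF assms(1)])
    show "int m \<in> fst ` K" using mK by force
    show "x - y \<in> fst ` K" if xy: "x \<in> fst ` K" "y \<in> fst ` K" for x y
    proof -
      obtain p q where "p \<in> K" "q \<in> K" "x = fst p" "y = fst q" using xy by blast
      then show ?thesis using lattice_diff[OF K, of p q] by (auto intro!: image_eqI[of _ _ "p - q"])
    qed
  qed blast
  obtain b where b: "b dvd n" "{y. (0, y) \<in> K} = {y. int b dvd y}"
  proof (rule int_subgroup_eq_multiples[OF assms(2)])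
    show "int n \<in> {y. (0, y) \<in> K}" using nK by simp
    show "x - y \<in> {y. (0, y) \<in> K}" if "x \<in> {y. (0, y) \<in> K}" "y \<in> {y. (0, y) \<in> K}" for x y
      using that lattice_diff[OF K, of "(0, x)" "(0, y)"] by simp
  qed blast
  have b_iff: "(0, y) \<in> K \<longleftrightarrow> int b dvd y" for y
    using b(2) by blast
  have pos: "a > 0" "b > 0" using a(1) b(1) assms by (auto intro: Nat.gr0I)
  have "int a \<in> fst ` K" by (simp add: a)
  then obtain s where s: "(int a, s) \<in> K" by auto
  \<comment> \<open>Any lift (a, s) of \<open>a\<close> will do; subtracting a multiple of (0, b)
    brings its second entry into the range from 0 to b - 1.\<close>
  define t where "t = nat (s mod int b)"
  have t: "int t = s mod int b" using pos by (simp add: t_def)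
  have "(0, s div int b * int b) \<in> K" by (simp add: b_iff)
  then have at: "(int a, int t) \<in> K"
    using lattice_diff[OF K s, of "(0, s div int b * int b)"] by (simp add: t minus_div_mult_eq_mod)
  have mem: "(x, y) \<in> K \<longleftrightarrow> int a dvd x \<and> int b dvd y - x div int a * int t" for x y
  proof (cases "int a dvd x")
    case True
    \<comment> \<open>The multiple of (a, t) lying over \<open>x\<close> reduces membership of (x,
      y) to membership in the fibre over 0.\<close>
    then have base: "(x, x div int a * int t) \<in> K"
      using lattice_scale[OF K at, of "x div int a"] by simp
    have "(x, y) \<in> K \<longleftrightarrow> (0, y - x div int a * int t) \<in> K"
      using lattice_diff[OF K _ base, of "(x, y)"] lattice_add[OF K _ base, of 0 "y - x div int a * int t"]
      by auto
    then show ?thesis using b_iff True by simp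
  next
    case False
    then show ?thesis using a(2) by (metis fst_conv image_eqI mem_Collect_eq)
  qed
  have "int b dvd int (m div a) * int t"
    using mem[of "int m" 0] mK by (simp add: zdiv_int)
  then have "b dvd (m div a) * t" by (metis of_nat_dvd_iff of_nat_mult)
  moreover have "t < b" using pos t by (metis of_nat_less_iff of_nat_0_less_iff pos_mod_bound)
  ultimately have "(a, b, t) \<in> hermite_params m n"
    using a(1) b(1) by (simp add: hermite_params_def)
  moreover have "K = hermite_lattice (a, b, t)"
    using mem by (auto simp: hermite_lattice_def)
  ultimately show ?thesis by blast
qed

section \<open>Counting the Hermite parameters\<close>

text \<open>After cancelling \<open>g = gcd k b\<close>, the cofactor \<open>k div g\<close> is
  coprime to \<open>c = b div g\<close>, so the solutions are the multiples of \<open>c\<close>, and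
  \<open>g\<close> of them lie below \<open>b = c * g\<close>.\<close>

lemma card_multiples_mod:
  fixes b k :: nat
  assumes "b \<ge> 1"
  shows "card {t. t < b \<and> b dvd k * t} = gcd k b"
proof -
  define g c where "g = gcd k b" and "c = b div g"
  have g: "g > 0" using assms by (simp add: g_def)
  have b: "b = c * g" by (simp add: c_def g_def)
  have c: "c > 0" using b assms by (cases c) auto
  have "coprime c (k div g)"
    using div_gcd_coprime[of k b] assms by (simp add: c_def g_def coprime_commute)
  moreover have "k = (k div g) * g" by (simp add: g_def)
  ultimately have dvd_iff: "b dvd k * t \<longleftrightarrow> c dvd t" for t
    using g by (metis b coprime_dvd_mult_right_iff mult.assoc mult.commute nat_mult_dvd_cancel1)
  have "{t. t < b \<and> b dvd k * t} = (\<lambda>s. c * s) ` {..<g}"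
    unfolding dvd_iff using c by (auto simp: b)
  then show ?thesis
    using c by (simp add: card_image inj_on_def g_def)
qed

lemma card_hermite_params:
  assumes "m \<ge> 1" "n \<ge> 1"
  shows "card (hermite_params m n) = (\<Sum>i | i dvd m. \<Sum>j | j dvd n. gcd i j)"
proof -
  have fin: "finite {d. d dvd m}" "finite {d. d dvd n}" using assms by auto
  have finb: "finite {t. t < b \<and> b dvd k * t}" for b k :: nat by simp
  have "card (hermite_params m n)
      = (\<Sum>a | a dvd m. \<Sum>b | b dvd n. card {t. t < b \<and> b dvd (m div a) * t})"
    unfolding hermite_params_def using fin finb by (simp add: card_SigmaI)
  also have "\<dots> = (\<Sum>a | a dvd m. \<Sum>b | b dvd n. gcd (m div a) b)"
  proof (intro sum.cong refl card_multiples_mod)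
    show "b \<ge> 1" if "b \<in> {d. d dvd n}" for b
      using that assms by (cases b) auto
  qed
  also have "\<dots> = (\<Sum>i | i dvd m. \<Sum>j | j dvd n. gcd i j)"
    \<comment> \<open>Passing to the complementary divisor \<open>m div i\<close> is an involution
      on the divisors of \<open>m\<close>.\<close>
    by (rule sum.reindex_bij_witness[of _ "\<lambda>i. m div i" "\<lambda>i. m div i"]) (use assms in auto)
  finally show ?thesis .
qed

section \<open>The totient form of the sum\<close>

lemma card_divisors_multiple_of:
  fixes m t :: nat
  assumes "m \<ge> 1" "t dvd m"
  shows "card {i. i dvd m \<and> t dvd i} = divisor_count (m div t)"
proof -
  have t: "t > 0" using assms by (auto intro: Nat.gr0I)
  have "{i. i dvd m \<and> t dvd i} = (\<lambda>d. t * d) ` {d. d dvd m div t}"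
    using assms t by (auto simp: dvd_div_iff_mult mult.commute elim!: dvdE)
  then show ?thesis
    using t by (simp add: divisor_count_def card_image inj_on_def)
qed

lemma sum_gcd_divisors_eq_totient_sum:
  fixes m n :: nat
  assumes "m \<ge> 1" "n \<ge> 1"
  shows "(\<Sum>i | i dvd m. \<Sum>j | j dvd n. gcd i j)
       = (\<Sum>t | t dvd gcd m n. totient t * divisor_count (m div t) * divisor_count (n div t))"
proof -
  let ?M = "{d. d dvd m}" and ?N = "{d. d dvd n}" and ?T = "{d. d dvd gcd m n}"
  have fin: "finite ?M" "finite ?N" "finite ?T" using assms by auto
  \<comment> \<open>Summing over the fixed set \<open>?T\<close> makes the sums exchangeable, and
    nesting the tests lets the test on \<open>i\<close> leave the sum over \<open>j\<close>.\<close>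
  have gcd: "gcd i j = (\<Sum>t\<in>?T. (if t dvd i then if t dvd j then totient t else 0 else 0))"
    if "i \<in> ?M" "j \<in> ?N" for i j
  proof -
    have "gcd i j = (\<Sum>t | t dvd gcd i j. totient t)" by (simp only: totient_divisor_sum)
    also have "{t. t dvd gcd i j} = {t \<in> ?T. t dvd i \<and> t dvd j}"
      using that by (auto intro: dvd_trans)
    also have "(\<Sum>t\<in>\<dots>. totient t) = (\<Sum>t\<in>?T. if t dvd i \<and> t dvd j then totient t else 0)"
      by (rule sum.inter_filter[OF fin(3)])
    finally show ?thesis by (simp only: if_if_eq_conj)
  qed
  have "(\<Sum>i\<in>?M. \<Sum>j\<in>?N. gcd i j)
      = (\<Sum>i\<in>?M. \<Sum>j\<in>?N. \<Sum>t\<in>?T. (if t dvd i then if t dvd j then totient t else 0 else 0))"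
    by (intro sum.cong refl gcd)
  also have "\<dots> = (\<Sum>i\<in>?M. \<Sum>t\<in>?T. \<Sum>j\<in>?N. (if t dvd i then if t dvd j then totient t else 0 else 0))"
    by (intro sum.cong refl sum.swap)
  also have "\<dots> = (\<Sum>t\<in>?T. \<Sum>i\<in>?M. \<Sum>j\<in>?N. (if t dvd i then if t dvd j then totient t else 0 else 0))"
    by (rule sum.swap)
  also have "\<dots> = (\<Sum>t\<in>?T. totient t * card {i\<in>?M. t dvd i} * card {j\<in>?N. t dvd j})"
  proof (rule sum.cong[OF refl])
    fix t
    have "(\<Sum>j\<in>?N. (if t dvd i then if t dvd j then totient t else 0 else 0))
        = (if t dvd i then card {j\<in>?N. t dvd j} * totient t else 0)" for i
      using fin by (simp flip: sum.inter_filter)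
    then show "(\<Sum>i\<in>?M. \<Sum>j\<in>?N. (if t dvd i then if t dvd j then totient t else 0 else 0))
        = totient t * card {i\<in>?M. t dvd i} * card {j\<in>?N. t dvd j}"
      using fin by (simp flip: sum.inter_filter)
  qed
  also have "\<dots> = (\<Sum>t\<in>?T. totient t * divisor_count (m div t) * divisor_count (n div t))"
    using assms by (intro sum.cong refl) (simp add: card_divisors_multiple_of)
  finally show ?thesis .
qed

theorem theorem4p1:
  fixes m n :: nat
  assumes "m \<ge> 1" and "n \<ge> 1"
  shows "subgroup_count m n = (\<Sum>(i, j) \<in> {d. d dvd m} \<times> {d. d dvd n}. gcd i j)
       \<and> (\<Sum>(i, j) \<in> {d. d dvd m} \<times> {d. d dvd n}. gcd i j)
           = (\<Sum>t | t dvd gcd m n. totient t * divisor_count (m div t) * divisor_count (n div t))"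
proof -
  have "hermite_lattice ` hermite_params m n = period_lattices m n"
    using hermite_lattice_in_period_lattices period_lattice_is_hermite[OF assms] by blast
  then have "card (period_lattices m n) = card (hermite_params m n)"
    using card_image[OF inj_on_hermite_lattice[OF assms(1)]] by metis
  then show ?thesis
    using assms by (simp add: card_subgroups_eq_card_period_lattices card_hermite_params
        sum_gcd_divisors_eq_totient_sum flip: sum.cartesian_product)
qed

end
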